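(* Consider a threshold service policy $(T,\mu_l,\mu_h)$, where $T$ is a positive integer and $0<\mu_l<\mu_h$. Let $\hat n_0-1$ and $\hat n_0$ be two consecutive integers in $\{T+1,T+2,\dots\}$ such that the pure threshold strategies $\underline{\tilde p}(\hat n_0-1)$ and $\underline{\tilde p}(\hat n_0)$ are both recurrent-class equilibria, and assume that $$W\left(\hat n_0-2,\hat n_0-1;\underline{\tilde p}(\hat n_0-1)\right)>\tilde R-\frac1{\mu_h}\quad\text{and}\quad W\left(\hat n_0-1,\hat n_0;\underline{\tilde p}(\hat n_0)\right)<\tilde R .$$ Then there exists $x\in(\hat n_0-1,\hat n_0)$ such that the mixed threshold strategy $\underline{\hat p}(x)$ is a recurrent-class equilibrium.
   Context: Model. Customers arrive at a single-server first-come-first-served queue according to a Poisson process with rate $\lambda>0$. Threshold service policy $(T,\mu_l,\mu_h)$: when $n\ge1$ customers are in the system, service is provided at exponential rate $\mu_n$, where $\mu_n=\mu_l$ if $n\le T$ and $\mu_n=\mu_h$ if $n>T$. Each arriving customer observes the number of customers present and either joins or balks. A joining customer receives a reward $R\ge0$ at service completion and pays $C>0$ per unit of time in the system, with no reneging. Let $\tilde R=R/C$. A strategy is a vector $\underline p=(p_0,p_1,\dots)\in[0,1]^\infty$, where $p_n$ is the probability that a customer who finds $n$ customers upon arrival joins. Let $n_0(\underline p)=\min\{n:p_n=0\}$. Pure threshold strategy $\underline{\tilde p}(n_0)$: $p_n=1$ for $n\le n_0-1$ and $p_n=0$ for $n\ge n_0$. Mixed threshold strategy $\underline{\hat p}(x)$,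 $x>0$ not an integer: with $n_0=\lfloor x\rfloor+1$, set $p_n=1$ for $n\le n_0-2$, $p_{\lfloor x\rfloor}=x-\lfloor x\rfloor\in(0,1)$, and $p_n=0$ for $n\ge n_0$. Delay function. For $0\le n<m$, $W(n,m;\underline p)$ is the expected remaining sojourn time of a tagged customer in the system who has $n$ customers in front of her when there are $m$ customers in total (including her), when all future arrivals follow $\underline p$. That is, it is the expected time until departure of the continuous-time Markov chain started at $(n,m)$ with transitions $(i,k)\to(i,k+1)$ at rate $\lambda p_k$, $(i,k)\to(i-1,k-1)$ at rate $\mu_k$ if $i\ge1$, and $(0,k)\to$ departure at rate $\mu_k$. $W(n;\underline p)=W(n,n+1;\underline p)$ is the expected sojourn time of a customer who finds $n$ customers upon arrival and joins. Recurrent-class equilibria. A strategy $\underline p$ with $n_0(\underline p)<\infty$ is a recurrent-class equilibrium if, for every $n\le n_0(\underline p)$: $\tilde R-W(n;\underline p)\le0$ if $p_n=0$; $\tilde R-W(n;\underline p)\ge0$ if $p_n=1$; and $\tilde R-W(n;\underline p)=0$ if $p_n\in(0,1)$. *)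

theory Defs
  imports "HOL-Probability.Probability"
begin

definition service_rate :: "nat \<Rightarrow> real \<Rightarrow> real \<Rightarrow> nat \<Rightarrow> real" where
  "service_rate T \<mu>\<^sub>l \<mu>\<^sub>h n = (if n \<le> T then \<mu>\<^sub>l else \<mu>\<^sub>h)"


section \<open>Strategies\<close>

definition strategy :: "(nat \<Rightarrow> real) \<Rightarrow> bool" where
  "strategy p \<longleftrightarrow> (\<forall>n. 0 \<le> p n \<and> p n \<le> 1)"

text \<open>Only meaningful when \<open>p\<close> vanishes somewhere.\<close>

definition balking_level :: "(nat \<Rightarrow> real) \<Rightarrow> nat" where
  "balking_level p = (LEAST n. p n = 0)"

definition pure_threshold :: "nat \<Rightarrow> nat \<Rightarrow> real" where
  "pure_threshold n\<^sub>0 n = (if n < n\<^sub>0 then 1 else 0)"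

text \<open>Used only for positive non-integer \<open>x\<close>.\<close>

definition mixed_threshold :: "real \<Rightarrow> nat \<Rightarrow> real" where
  "mixed_threshold x n =
     (let n\<^sub>0 = nat \<lfloor>x\<rfloor> + 1
      in if n + 2 \<le> n\<^sub>0 then 1
         else if n = nat \<lfloor>x\<rfloor> then x - of_int \<lfloor>x\<rfloor>
         else 0)"


section \<open>The chain of the tagged customer and the delay function\<close>

text \<open>
  A state \<open>Some (i, k)\<close> means that the tagged customer has \<open>i\<close> customers in front of her and
  that \<open>k\<close> customers, including her, are present; \<open>None\<close> means that she has departed.

  The continuous-time chain is built from competing exponential clocks.  At each jump an
  independent pair \<open>(a, b)\<close> of rate-1 exponential variables is drawn; in \<open>Some (i, k)\<close>
  the next joining customer is due after \<open>a / (lam p\<^sub>k)\<close> and the next service completion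
  after \<open>b / \<mu>\<^sub>k\<close>, which are independent exponential variables of rates \<open>lam p\<^sub>k\<close> and
  \<open>\<mu>\<^sub>k\<close>.  The chain stays for the minimum of the two and makes the jump of the clock that
  rings first.  Division is in \<^typ>\<open>ennreal\<close>, so a clock of rate 0 almost surely never rings.
\<close>

type_synonym tagged_state = "(nat \<times> nat) option"

definition join_clock :: "real \<Rightarrow> (nat \<Rightarrow> real) \<Rightarrow> nat \<Rightarrow> real \<Rightarrow> ennreal" where
  "join_clock lam p k a = ennreal a / ennreal (lam * p k)"

definition service_clock :: "(nat \<Rightarrow> real) \<Rightarrow> nat \<Rightarrow> real \<Rightarrow> ennreal" where
  "service_clock \<mu> k b = ennreal b / ennreal (\<mu> k)"

fun next_state ::
  "real \<Rightarrow> (nat \<Rightarrow> real) \<Rightarrow> (nat \<Rightarrow> real) \<Rightarrow> tagged_state \<Rightarrow> real \<times> real \<Rightarrow> tagged_state" where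
  "next_state lam \<mu> p None ab = None"
| "next_state lam \<mu> p (Some (i, k)) ab =
     (if join_clock lam p k (fst ab) < service_clock \<mu> k (snd ab) then Some (i, k + 1)
      else if i \<ge> 1 then Some (i - 1, k - 1)
      else None)"

fun holding_time ::
  "real \<Rightarrow> (nat \<Rightarrow> real) \<Rightarrow> (nat \<Rightarrow> real) \<Rightarrow> tagged_state \<Rightarrow> real \<times> real \<Rightarrow> ennreal" where
  "holding_time lam \<mu> p None ab = 0"
| "holding_time lam \<mu> p (Some (i, k)) ab =
     min (join_clock lam p k (fst ab)) (service_clock \<mu> k (snd ab))"

primrec jump_chain ::
  "real \<Rightarrow> (nat \<Rightarrow> real) \<Rightarrow> (nat \<Rightarrow> real) \<Rightarrow> tagged_state \<Rightarrow> (real \<times> real) stream \<Rightarrow> nat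
     \<Rightarrow> tagged_state" where
  "jump_chain lam \<mu> p s \<omega> 0 = s"
| "jump_chain lam \<mu> p s \<omega> (Suc j) = next_state lam \<mu> p (jump_chain lam \<mu> p s \<omega> j) (\<omega> !! j)"

definition departure_time ::
  "real \<Rightarrow> (nat \<Rightarrow> real) \<Rightarrow> (nat \<Rightarrow> real) \<Rightarrow> tagged_state \<Rightarrow> (real \<times> real) stream
     \<Rightarrow> ennreal" where
  "departure_time lam \<mu> p s \<omega> =
     (\<Sum>j. holding_time lam \<mu> p (jump_chain lam \<mu> p s \<omega> j) (\<omega> !! j))"

definition exponential_law :: "real measure" where
  "exponential_law = density lborel (\<lambda>t. ennreal (exponential_density 1 t))"

definition clocks :: "(real \<times> real) stream measure" where
  "clocks = stream_space (exponential_law \<Otimes>\<^sub>M exponential_law)"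

text \<open>
  The expectation is finite whenever \<open>lam p\<^sub>k\<close> is bounded and \<open>\<mu>\<close> is bounded and bounded away
  from 0: the chain does not explode and the tagged customer leaves at the \<open>(n + 1)\<close>-st
  service completion.  Hence \<^const>\<open>enn2real\<close> loses nothing for threshold service policies.
\<close>

definition delay ::
  "real \<Rightarrow> (nat \<Rightarrow> real) \<Rightarrow> nat \<Rightarrow> nat \<Rightarrow> (nat \<Rightarrow> real) \<Rightarrow> real" where
  "delay lam \<mu> n m p = enn2real (\<integral>\<^sup>+\<omega>. departure_time lam \<mu> p (Some (n, m)) \<omega> \<partial>clocks)"

abbreviation arrival_delay :: "real \<Rightarrow> (nat \<Rightarrow> real) \<Rightarrow> nat \<Rightarrow> (nat \<Rightarrow> real) \<Rightarrow> real" where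
  "arrival_delay lam \<mu> n p \<equiv> delay lam \<mu> n (n + 1) p"


section \<open>Equilibria\<close>

text \<open>\<open>r\<close> is the normalised reward, i.e. the reward divided by the waiting cost rate.\<close>

definition recurrent_class_equilibrium ::
  "real \<Rightarrow> (nat \<Rightarrow> real) \<Rightarrow> real \<Rightarrow> (nat \<Rightarrow> real) \<Rightarrow> bool" where
  "recurrent_class_equilibrium lam \<mu> r p \<longleftrightarrow>
     strategy p \<and> (\<exists>n. p n = 0) \<and>
     (\<forall>n \<le> balking_level p.
        (p n = 0 \<longrightarrow> r - arrival_delay lam \<mu> n p \<le> 0) \<and>
        (p n = 1 \<longrightarrow> r - arrival_delay lam \<mu> n p \<ge> 0) \<and>
        (0 < p n \<and> p n < 1 \<longrightarrow> r - arrival_delay lam \<mu> n p = 0))"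

end

theory Submission
  imports Defs
begin

text \<open>
  Put \<open>M = N - 1\<close> and let \<open>q\<close> be the joining probability at \<open>M\<close>, so that \<open>q = 0\<close> and \<open>q = 1\<close> are the
  two pure strategies and \<open>0 < q < 1\<close> the mixed ones.  First-step analysis of the jump chain gives
  the delay \<open>W q i k\<close> a finite triangular linear recursion, hence continuity in \<open>q\<close>.  Since
  \<open>W 0 M (M + 1) = 1 / \<mu>\<^sub>h + W 0 (M - 1) M\<close> exceeds the reward and \<open>W 1 M (M + 1)\<close> is below it, some
  \<open>q\<close> makes a customer who finds \<open>M\<close> others indifferent; one who finds \<open>M + 1\<close> waits \<open>1 / \<mu>\<^sub>h\<close> longer
  and balks.  Below \<open>M\<close> nothing is lost by moving from \<open>0\<close> to \<open>q\<close>: as the service rate increases with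
  the queue length, additional customers behind the tagged one can only speed her up, so
  \<open>W q \<le> W 0\<close>.
\<close>

section \<open>The race of the two clocks\<close>

lemma prob_space_exponential_law: "prob_space exponential_law"
  unfolding exponential_law_def by (rule prob_space_exponential_density) simp

lemma (in prob_space) emeasure_compl_one:
  "A \<in> events \<Longrightarrow> emeasure M (space M - A) = 1 - emeasure M A"
  by (simp add: emeasure_compl emeasure_space_1)

interpretation law: prob_space exponential_law
  by (rule prob_space_exponential_law)

interpretation laws: pair_prob_space exponential_law exponential_law ..

lemma sets_exponential_law [measurable_cong, simp]: "sets exponential_law = sets borel"
  by (simp add: exponential_law_def)

lemma space_exponential_law [simp]: "space exponential_law = UNIV"
  by (simp add: exponential_law_def)

lemma AE_exponential_law_pos: "AE t in exponential_law. 0 < t"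
proof -
  have "AE t in lborel. t \<noteq> (0 :: real)"
    by (rule AE_lborel_singleton)
  then show ?thesis
    unfolding exponential_law_def
    by (subst AE_density) (auto simp: exponential_density_def elim!: eventually_mono)
qed

lemma AE_clock_pair_pos:
  "AE ab in exponential_law \<Otimes>\<^sub>M exponential_law. 0 < fst ab \<and> 0 < snd ab"
proof -
  have "AE ab in exponential_law \<Otimes>\<^sub>M exponential_law. case ab of (a, b) \<Rightarrow> 0 < a \<and> 0 < b"
  proof (rule laws.AE_pair_measure)
    show "AE a in exponential_law. AE b in exponential_law. case (a, b) of (a, b) \<Rightarrow> 0 < a \<and> 0 < b"
      using AE_exponential_law_pos by (auto elim!: eventually_mono)
  qed measurable
  then show ?thesis
    by (simp add: case_prod_beta')
qed

lemma emeasure_exponential_law_greaterThan: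
  assumes "0 \<le> t"
  shows "emeasure exponential_law {t<..} = ennreal (exp (- t))"
proof -
  have "emeasure exponential_law {..t} = ennreal (1 - exp (- t))"
    using assms emeasure_erlang_density[of 1 0 t]
    by (simp add: exponential_law_def erlang_CDF_0)
  moreover have "UNIV - {..t} = {t<..}"
    by auto
  ultimately show ?thesis
    using emeasure_compl[of "{..t}" exponential_law] law.emeasure_space_1 assms
    by (simp flip: ennreal_1 add: ennreal_minus)
qed

lemma emeasure_both_clocks_exceed:
  assumes "0 \<le> s" "0 \<le> t"
  shows "emeasure (exponential_law \<Otimes>\<^sub>M exponential_law) ({s<..} \<times> {t<..}) = ennreal (exp (- (s + t)))"
  using assms
  by (subst law.emeasure_pair_measure_Times)
     (simp_all add: emeasure_exponential_law_greaterThan flip: ennreal_mult exp_add)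

text \<open>Returns the clocks to real arithmetic off the null set of nonpositive draws. A rate
  \<open>c\<close> that is not positive becomes 0 in \<open>ennreal\<close>, where a positive number
  divided by 0 is infinite.\<close>

lemma clock_eq:
  assumes "0 < t"
  shows "ennreal t / ennreal c = (if 0 < c then ennreal (t / c) else \<infinity>)"
  using assms by (auto simp: divide_ennreal ennreal_neg ennreal_divide_zero)

text \<open>The case \<open>\<alpha> = 0\<close> is a joining clock that never rings, where \<open>/\<close> on the reals would give 0.\<close>

definition race_time :: "real \<Rightarrow> real \<Rightarrow> real \<times> real \<Rightarrow> real" where
  "race_time \<alpha> \<beta> ab = (if 0 < \<alpha> then min (fst ab / \<alpha>) (snd ab / \<beta>) else snd ab / \<beta>)"

text \<open>The race lasts beyond \<open>t\<close> iff both clocks do, so by independence its tail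
  is a product of two exponentials.\<close>

lemma distributed_race_time:
  assumes "0 \<le> \<alpha>" "0 < \<beta>"
  shows "distributed (exponential_law \<Otimes>\<^sub>M exponential_law) lborel (race_time \<alpha> \<beta>)
           (exponential_density (\<alpha> + \<beta>))"
proof (rule exponential_distributedI)
  let ?E = "exponential_law \<Otimes>\<^sub>M exponential_law"
  show [measurable]: "race_time \<alpha> \<beta> \<in> borel_measurable ?E"
    unfolding race_time_def by measurable
  show "0 < \<alpha> + \<beta>"
    using assms by simp
  fix t :: real
  assume t: "0 \<le> t"
  have "emeasure ?E {ab \<in> space ?E. t < race_time \<alpha> \<beta> ab} =
    emeasure ?E ({\<alpha> * t<..} \<times> {\<beta> * t<..})"
  proof (rule emeasure_eq_AE)
    \<comment> \<open>For \<open>\<alpha> = 0\<close> the first side of the rectangle only asks for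
      a positive draw, which is almost sure, so one rectangle serves both cases of
      \<open>race_time\<close>.\<close>
    show "AE ab in ?E. ab \<in> {ab \<in> space ?E. t < race_time \<alpha> \<beta> ab} \<longleftrightarrow> ab \<in> {\<alpha> * t<..} \<times> {\<beta> * t<..}"
      using AE_clock_pair_pos
    proof eventually_elim
      case (elim ab)
      then show ?case
        using assms t by (cases ab) (auto simp: race_time_def space_pair_measure field_simps)
    qed
    show "{ab \<in> space ?E. t < race_time \<alpha> \<beta> ab} \<in> sets ?E"
      by measurable
    show "{\<alpha> * t<..} \<times> {\<beta> * t<..} \<in> sets ?E"
      by (rule pair_measureI) simp_all
  qed
  also have "\<dots> = ennreal (exp (- t * (\<alpha> + \<beta>)))"
    using assms t by (simp add: emeasure_both_clocks_exceed algebra_simps)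
  finally have *: "emeasure ?E {ab \<in> space ?E. t < race_time \<alpha> \<beta> ab} = ennreal (exp (- t * (\<alpha> + \<beta>)))" .
  have "{ab \<in> space ?E. race_time \<alpha> \<beta> ab \<le> t} =
      space ?E - {ab \<in> space ?E. t < race_time \<alpha> \<beta> ab}"
    by auto
  moreover have "{ab \<in> space ?E. t < race_time \<alpha> \<beta> ab} \<in> sets ?E"
    by measurable
  ultimately show "emeasure ?E {ab \<in> space ?E. race_time \<alpha> \<beta> ab \<le> t} = 1 - ennreal (exp (- t * (\<alpha> + \<beta>)))"
    using * by (simp only: laws.emeasure_compl_one)
qed

lemma nn_integral_race:
  assumes "0 \<le> \<alpha>" "0 < \<beta>"
  shows "(\<integral>\<^sup>+ab. min (ennreal (fst ab) / ennreal \<alpha>) (ennreal (snd ab) / ennreal \<beta>)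
           \<partial>(exponential_law \<Otimes>\<^sub>M exponential_law)) = ennreal (1 / (\<alpha> + \<beta>))"
proof -
  let ?E = "exponential_law \<Otimes>\<^sub>M exponential_law"
  have "(\<integral>\<^sup>+ab. min (ennreal (fst ab) / ennreal \<alpha>) (ennreal (snd ab) / ennreal \<beta>) \<partial>?E)
      = (\<integral>\<^sup>+ab. ennreal (race_time \<alpha> \<beta> ab) \<partial>?E)"
  proof (rule nn_integral_cong_AE)
    show "AE ab in ?E. min (ennreal (fst ab) / ennreal \<alpha>) (ennreal (snd ab) / ennreal \<beta>)
        = ennreal (race_time \<alpha> \<beta> ab)"
      using AE_clock_pair_pos
    proof eventually_elim
      case (elim ab)
      then show ?case
        using assms by (auto simp: race_time_def clock_eq min_def top_unique)
    qed
  qed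
  also have "\<dots> = (\<integral>\<^sup>+t. ennreal (exponential_density (\<alpha> + \<beta>) t) * ennreal t \<partial>lborel)"
    using assms by (intro distributed_nn_integral[OF distributed_race_time, symmetric]) auto
  \<comment> \<open>The mean is read off as the first moment of the Erlang law with shape parameter
    0, which is the exponential law.\<close>
  also have "\<dots> = (\<integral>\<^sup>+t. ennreal (exponential_density (\<alpha> + \<beta>) t * t ^ 1) \<partial>lborel)"
    using assms by (intro nn_integral_cong) (simp add: ennreal_mult' exponential_density_nonneg)
  also have "\<dots> = ennreal (1 / (\<alpha> + \<beta>))"
    using assms nn_integral_erlang_ith_moment[of "\<alpha> + \<beta>" 0 1] by simp
  finally show ?thesis .
qed

text \<open>Given the draw \<open>a\<close> of the joining clock, the service clock is later with
  probability \<open>exp (- (a * \<beta> / \<alpha>))\<close>, which is integrated over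
  \<open>a\<close>. A joining clock of rate 0 loses almost surely and is treated apart.\<close>

lemma emeasure_race:
  assumes "0 \<le> \<alpha>" "0 < \<beta>"
  shows "emeasure (exponential_law \<Otimes>\<^sub>M exponential_law)
      {ab. ennreal (fst ab) / ennreal \<alpha> < ennreal (snd ab) / ennreal \<beta>} = ennreal (\<alpha> / (\<alpha> + \<beta>))"
proof -
  let ?E = "exponential_law \<Otimes>\<^sub>M exponential_law"
  let ?A = "{ab. ennreal (fst ab) / ennreal \<alpha> < ennreal (snd ab) / ennreal \<beta>}"
  have [measurable]: "?A \<in> sets ?E"
  proof -
    have "{ab \<in> space ?E. ennreal (fst ab) / ennreal \<alpha> < ennreal (snd ab) / ennreal \<beta>} \<in> sets ?E"
      by measurable
    then show ?thesis
      by (simp add: space_pair_measure)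
  qed
  show ?thesis
  proof (cases "\<alpha> = 0")
    case True
    have "emeasure ?E ?A = emeasure ?E {}"
    proof (rule emeasure_eq_AE)
      show "AE ab in ?E. ab \<in> ?A \<longleftrightarrow> ab \<in> {}"
        using AE_clock_pair_pos
        by eventually_elim (simp add: True clock_eq assms)
    qed (use \<open>?A \<in> sets ?E\<close> in simp_all)
    then show ?thesis
      by (simp add: True)
  next
    case False
    then have \<alpha>: "0 < \<alpha>"
      using assms by simp
    \<comment> \<open>The integrand \<open>exp (- a) * exp (- (a * \<beta> / \<alpha>))\<close> met
      below decays at rate \<open>c\<close>, so it is \<open>1 / c\<close> times an exponential
      density of mass 1.\<close>
    define c where "c = (\<alpha> + \<beta>) / \<alpha>"
    have c: "0 < c" "c = 1 + \<beta> / \<alpha>"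
      using \<alpha> assms by (auto simp: c_def field_simps)
    have "emeasure ?E ?A = (\<integral>\<^sup>+a. emeasure exponential_law (Pair a -` ?A) \<partial>exponential_law)"
      by (rule law.emeasure_pair_measure_alt) fact
    also have "\<dots> = (\<integral>\<^sup>+a. ennreal (exp (- (a * \<beta> / \<alpha>))) \<partial>exponential_law)"
    proof (rule nn_integral_cong_AE)
      show "AE a in exponential_law.
          emeasure exponential_law (Pair a -` ?A) = ennreal (exp (- (a * \<beta> / \<alpha>)))"
        using AE_exponential_law_pos
      proof eventually_elim
        case (elim a)
        have "emeasure exponential_law (Pair a -` ?A) = emeasure exponential_law {a * \<beta> / \<alpha><..}"
        proof (rule emeasure_eq_AE)
          show "AE b in exponential_law. b \<in> Pair a -` ?A \<longleftrightarrow> b \<in> {a * \<beta> / \<alpha><..}"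
            using AE_exponential_law_pos
          proof eventually_elim
            case (elim b)
            then show ?case
              using \<alpha> assms \<open>0 < a\<close> by (simp add: clock_eq ennreal_less_iff field_simps)
          qed
          show "Pair a -` ?A \<in> sets exponential_law"
            by (rule sets_Pair1) fact
        qed simp
        then show ?case
          using elim \<alpha> assms by (simp add: emeasure_exponential_law_greaterThan)
      qed
    qed
    also have "\<dots> = (\<integral>\<^sup>+a. ennreal (exponential_density 1 a) * ennreal (exp (- (a * \<beta> / \<alpha>))) \<partial>lborel)"
      unfolding exponential_law_def by (rule nn_integral_density) auto
    also have "\<dots> = (\<integral>\<^sup>+a. ennreal (1 / c) * ennreal (exponential_density c a) \<partial>lborel)"
    proof (rule nn_integral_cong)
      fix a :: real
      have "exponential_density 1 a * exp (- (a * \<beta> / \<alpha>)) = 1 / c * exponential_density c a"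
        using c(1) by (simp add: exponential_density_def flip: exp_add) (simp add: c(2) algebra_simps)
      then show "ennreal (exponential_density 1 a) * ennreal (exp (- (a * \<beta> / \<alpha>)))
          = ennreal (1 / c) * ennreal (exponential_density c a)"
        using c(1) by (simp add: exponential_density_nonneg flip: ennreal_mult)
    qed
    also have "\<dots> = ennreal (1 / c) * emeasure (density lborel (exponential_density c)) UNIV"
      by (simp add: nn_integral_cmult emeasure_density)
    also have "\<dots> = ennreal (1 / c)"
      using prob_space.emeasure_space_1[OF prob_space_exponential_density[OF c(1)]] by simp
    finally show ?thesis
      by (simp add: c_def)
  qed
qed


section \<open>First-step analysis\<close>

text \<open>The expectation inside \<open>delay\<close> before \<open>enn2real\<close>: its
  first-step equation is proved in \<open>ennreal\<close>, and finiteness is then derived from that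
  equation.\<close>

definition expected_departure ::
  "real \<Rightarrow> (nat \<Rightarrow> real) \<Rightarrow> (nat \<Rightarrow> real) \<Rightarrow> tagged_state \<Rightarrow> ennreal" where
  "expected_departure lam \<mu> p s = (\<integral>\<^sup>+\<omega>. departure_time lam \<mu> p s \<omega> \<partial>clocks)"

section \<open>Measurability of the chain and of the departure time\<close>

lemma measurable_join_clock [measurable]: "join_clock lam p k \<in> borel_measurable borel"
  unfolding join_clock_def by measurable

lemma measurable_service_clock [measurable]: "service_clock \<mu> k \<in> borel_measurable borel"
  unfolding service_clock_def by measurable

lemma measurable_next_state [measurable]:
  "next_state lam \<mu> p s \<in> exponential_law \<Otimes>\<^sub>M exponential_law \<rightarrow>\<^sub>M count_space UNIV"
proof (cases s)
  case (Some ik)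
  then show ?thesis
    by (cases ik) (simp add: next_state.simps[abs_def])
qed (simp add: next_state.simps[abs_def])

lemma measurable_holding_time [measurable]:
  "holding_time lam \<mu> p s \<in> borel_measurable (exponential_law \<Otimes>\<^sub>M exponential_law)"
proof (cases s)
  case (Some ik)
  then show ?thesis
    by (cases ik) (simp add: holding_time.simps[abs_def])
qed (simp add: holding_time.simps[abs_def])

lemma measurable_jump_chain:
  "(\<lambda>\<omega>. jump_chain lam \<mu> p s \<omega> j) \<in> clocks \<rightarrow>\<^sub>M count_space UNIV"
proof (induction j)
  case (Suc j)
  have "(\<lambda>\<omega>. next_state lam \<mu> p s' (\<omega> !! j)) \<in> clocks \<rightarrow>\<^sub>M count_space UNIV" for s'
    unfolding clocks_def by measurable
  from measurable_compose_countable[OF this Suc] show ?case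
    by simp
qed simp

lemma measurable_departure_time [measurable]:
  "departure_time lam \<mu> p s \<in> borel_measurable clocks"
proof -
  have "(\<lambda>\<omega>. holding_time lam \<mu> p s' (\<omega> !! j)) \<in> borel_measurable clocks" for s' j
    unfolding clocks_def by measurable
  from measurable_compose_countable[OF this measurable_jump_chain]
  have [measurable]:
    "(\<lambda>\<omega>. holding_time lam \<mu> p (jump_chain lam \<mu> p s \<omega> j) (\<omega> !! j)) \<in> borel_measurable clocks" for j
    by simp
  show ?thesis
    unfolding departure_time_def by measurable
qed

section \<open>Restarting the chain after its first jump\<close>

lemma jump_chain_Stream_Suc:
  "jump_chain lam \<mu> p s (ab ## \<omega>) (Suc j) = jump_chain lam \<mu> p (next_state lam \<mu> p s ab) \<omega> j"
proof (induction j)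
  case (Suc j)
  show ?case
    by (subst jump_chain.simps(2), subst Suc) simp
qed simp

lemma departure_time_Stream:
  "departure_time lam \<mu> p s (ab ## \<omega>) =
     holding_time lam \<mu> p s ab + departure_time lam \<mu> p (next_state lam \<mu> p s ab) \<omega>"
  unfolding departure_time_def
  by (subst suminf_offset[of _ 1]) (simp_all add: jump_chain_Stream_Suc del: jump_chain.simps(2))

lemma departure_time_None [simp]: "departure_time lam \<mu> p None \<omega> = 0"
proof -
  have "jump_chain lam \<mu> p None \<omega> j = None" for j
    by (induction j) simp_all
  then show ?thesis
    by (simp add: departure_time_def)
qed

lemma expected_departure_None [simp]: "expected_departure lam \<mu> p None = 0"
  by (simp add: expected_departure_def)

text \<open>Head and tail of the stream are independent and the tail again has law
  \<open>clocks\<close>, so integrating over the tail restarts the chain in the next state.\<close>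

lemma expected_departure_first_step:
  "expected_departure lam \<mu> p s =
     (\<integral>\<^sup>+ab. holding_time lam \<mu> p s ab + expected_departure lam \<mu> p (next_state lam \<mu> p s ab)
        \<partial>(exponential_law \<Otimes>\<^sub>M exponential_law))"
proof -
  interpret S: prob_space clocks
    unfolding clocks_def by (rule laws.prob_space_stream_space)
  have "expected_departure lam \<mu> p s =
    (\<integral>\<^sup>+ab. (\<integral>\<^sup>+\<omega>. departure_time lam \<mu> p s (ab ## \<omega>) \<partial>clocks)
       \<partial>(exponential_law \<Otimes>\<^sub>M exponential_law))"
    unfolding expected_departure_def clocks_def
    by (rule laws.nn_integral_stream_space) (simp flip: clocks_def)
  also have "\<dots> = (\<integral>\<^sup>+ab. holding_time lam \<mu> p s ab + expected_departure lam \<mu> p (next_state lam \<mu> p s ab)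
        \<partial>(exponential_law \<Otimes>\<^sub>M exponential_law))"
    unfolding departure_time_Stream expected_departure_def
    by (intro nn_integral_cong) (simp add: nn_integral_add S.emeasure_space_1)
  finally show ?thesis .
qed

lemma expected_departure_Some:
  assumes "0 \<le> lam * p k" "0 < \<mu> k"
  defines "\<alpha> \<equiv> lam * p k"
  shows "expected_departure lam \<mu> p (Some (i, k)) =
    ennreal (1 / (\<alpha> + \<mu> k))
    + ennreal (\<alpha> / (\<alpha> + \<mu> k)) * expected_departure lam \<mu> p (Some (i, k + 1))
    + ennreal (\<mu> k / (\<alpha> + \<mu> k)) *
        expected_departure lam \<mu> p (if i \<ge> 1 then Some (i - 1, k - 1) else None)"
    (is "_ = _ + _ * ?u + _ * ?v")
proof -
  let ?E = "exponential_law \<Otimes>\<^sub>M exponential_law"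
  let ?A = "{ab. ennreal (fst ab) / ennreal \<alpha> < ennreal (snd ab) / ennreal (\<mu> k)}"
  have A: "?A \<in> sets ?E"
  proof -
    have "{ab \<in> space ?E. ennreal (fst ab) / ennreal \<alpha> < ennreal (snd ab) / ennreal (\<mu> k)} \<in> sets ?E"
      by measurable
    then show ?thesis
      by (simp add: space_pair_measure)
  qed
  have P: "emeasure ?E ?A = ennreal (\<alpha> / (\<alpha> + \<mu> k))"
    using assms by (intro emeasure_race) simp_all
  have "emeasure ?E (space ?E - ?A) = 1 - ennreal (\<alpha> / (\<alpha> + \<mu> k))"
    by (simp only: laws.emeasure_compl_one[OF A] P)
  also have "\<dots> = ennreal (\<mu> k / (\<alpha> + \<mu> k))"
    using assms by (simp add: ennreal_minus field_simps flip: ennreal_1)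
  finally have Q: "emeasure ?E (space ?E - ?A) = ennreal (\<mu> k / (\<alpha> + \<mu> k))" .
  \<comment> \<open>The value after the jump depends only on who wins the race; ties fall to the
    complement, as in \<open>next_state\<close>.\<close>
  have next_u_v: "expected_departure lam \<mu> p (next_state lam \<mu> p (Some (i, k)) ab)
      = ?u * indicator ?A ab + ?v * indicator (space ?E - ?A) ab" for ab
    by (simp add: join_clock_def service_clock_def \<alpha>_def space_pair_measure split: split_indicator)
  have "expected_departure lam \<mu> p (Some (i, k)) =
    (\<integral>\<^sup>+ab. holding_time lam \<mu> p (Some (i, k)) ab \<partial>?E)
    + ((\<integral>\<^sup>+ab. ?u * indicator ?A ab \<partial>?E) + (\<integral>\<^sup>+ab. ?v * indicator (space ?E - ?A) ab \<partial>?E))"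
  proof -
    have f: "(\<lambda>ab. ?u * indicator ?A ab) \<in> borel_measurable ?E"
      using A by (intro borel_measurable_times_ennreal borel_measurable_const borel_measurable_indicator)
    have g: "(\<lambda>ab. ?v * indicator (space ?E - ?A) ab) \<in> borel_measurable ?E"
      using A by (intro borel_measurable_times_ennreal borel_measurable_const
          borel_measurable_indicator sets.compl_sets)
    show ?thesis
      unfolding expected_departure_first_step[of lam \<mu> p "Some (i, k)"] next_u_v
        nn_integral_add[OF measurable_holding_time borel_measurable_add[OF f g]] nn_integral_add[OF f g] ..
  qed
  also have "(\<integral>\<^sup>+ab. holding_time lam \<mu> p (Some (i, k)) ab \<partial>?E) = ennreal (1 / (\<alpha> + \<mu> k))"
    using nn_integral_race[of \<alpha> "\<mu> k"] assms
    by (simp add: join_clock_def service_clock_def)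
  finally show ?thesis
    unfolding nn_integral_cmult_indicator[OF A] nn_integral_cmult_indicator[OF sets.compl_sets[OF A]] P Q
    by (simp only: mult.commute add.assoc)
qed

text \<open>Induction on \<open>i\<close>, and for each \<open>i\<close> on \<open>N - k\<close>: a
  service lowers \<open>i\<close>, a joining customer lowers \<open>N - k\<close>. From
  \<open>N\<close> on the joining term has coefficient 0 and vanishes whatever its value, since 0
  times infinity is 0 in \<open>ennreal\<close>.\<close>

lemma expected_departure_finite:
  assumes rates: "\<And>k. 0 \<le> lam * p k" "\<And>k. 0 < \<mu> k"
    and balk: "\<And>k. N \<le> k \<Longrightarrow> p k = 0"
  shows "expected_departure lam \<mu> p (Some (i, k)) < \<infinity>"
proof (induction i arbitrary: k)
  case (0 k)
  show ?case
  proof (induction "N - k" arbitrary: k)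
    case 0
    then show ?case
      by (subst expected_departure_Some) (simp_all add: rates balk)
  next
    case (Suc d)
    then have "expected_departure lam \<mu> p (Some (0, k + 1)) < \<infinity>"
      by simp
    then show ?case
      by (subst expected_departure_Some) (simp_all add: rates ennreal_mult_less_top)
  qed
next
  case (Suc i k)
  show ?case
  proof (induction "N - k" arbitrary: k)
    case 0
    then show ?case
      using Suc by (subst expected_departure_Some) (simp_all add: rates balk ennreal_mult_less_top)
  next
    case (Suc d)
    then have "expected_departure lam \<mu> p (Some (Suc i, k + 1)) < \<infinity>"
      by simp
    then show ?case
      using \<open>\<And>k. expected_departure lam \<mu> p (Some (i, k)) < \<infinity>\<close>
      by (subst expected_departure_Some) (simp_all add: rates ennreal_mult_less_top)
  qed
qed

text \<open>Finiteness moves the equation from \<open>ennreal\<close> to the reals; it is multiplied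
  by the total rate to be free of divisions.\<close>

lemma delay_first_step:
  assumes rates: "\<And>k. 0 \<le> lam * p k" "\<And>k. 0 < \<mu> k"
    and balk: "\<And>k. N \<le> k \<Longrightarrow> p k = 0"
  shows "(lam * p k + \<mu> k) * delay lam \<mu> i k p =
    1 + lam * p k * delay lam \<mu> i (k + 1) p
      + \<mu> k * (if i = 0 then 0 else delay lam \<mu> (i - 1) (k - 1) p)"
proof -
  let ?e = "expected_departure lam \<mu> p"
  have e: "?e (Some (i, k)) = ennreal (delay lam \<mu> i k p)" for i k
    using expected_departure_finite[of lam p \<mu> N i k] assms
    by (simp add: expected_departure_def delay_def)
  have nn: "0 \<le> delay lam \<mu> i k p" for i k
    by (simp add: delay_def)
  define v where "v = (if i = 0 then 0 else delay lam \<mu> (i - 1) (k - 1) p)"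
  have v: "?e (if i \<ge> 1 then Some (i - 1, k - 1) else None) = ennreal v" "0 \<le> v"
    by (simp_all add: v_def e nn)
  define s where "s = lam * p k + \<mu> k"
  have s: "0 < s"
    using rates[of k] by (simp add: s_def)
  have "ennreal (delay lam \<mu> i k p) =
      ennreal (1 / s + lam * p k / s * delay lam \<mu> i (k + 1) p + \<mu> k / s * v)"
    using expected_departure_Some[of lam p k \<mu> i] rates[of k] s nn v
    by (simp add: e ennreal_mult ennreal_plus del: times_divide_eq_left flip: s_def)
  then have "delay lam \<mu> i k p = 1 / s + lam * p k / s * delay lam \<mu> i (k + 1) p + \<mu> k / s * v"
    using rates[of k] s nn v(2) by (subst (asm) ennreal_inj) auto
  then have "s * delay lam \<mu> i k p = 1 + lam * p k * delay lam \<mu> i (k + 1) p + \<mu> k * v"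
    using s by (simp add: field_simps)
  then show ?thesis
    by (simp add: s_def v_def)
qed


section \<open>Delays between two consecutive pure thresholds\<close>

definition threshold_mix :: "nat \<Rightarrow> real \<Rightarrow> nat \<Rightarrow> real" where
  "threshold_mix M q n = (if n < M then 1 else if n = M then q else 0)"

lemma pure_threshold_eq_mix: "pure_threshold M = threshold_mix M 0"
  by (auto simp: pure_threshold_def threshold_mix_def)

lemma pure_threshold_Suc_eq_mix: "pure_threshold (Suc M) = threshold_mix M 1"
  by (auto simp: pure_threshold_def threshold_mix_def)

lemma mixed_threshold_eq_mix:
  assumes "0 < q" "q < 1"
  shows "mixed_threshold (real M + q) = threshold_mix M q"
proof -
  have "\<lfloor>real M + q\<rfloor> = int M"
    using assms by linarith
  then show ?thesis
    by (auto simp: fun_eq_iff mixed_threshold_def threshold_mix_def)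
qed

lemma balking_level_pure_threshold: "balking_level (pure_threshold M) = M"
  unfolding balking_level_def by (rule Least_equality) (auto simp: pure_threshold_def split: if_splits)

lemma balking_level_threshold_mix:
  "q \<noteq> 0 \<Longrightarrow> balking_level (threshold_mix M q) = Suc M"
  unfolding balking_level_def
  by (rule Least_equality) (auto simp: threshold_mix_def not_less_eq_eq split: if_splits)

lemma mono_service_rate: "\<mu>\<^sub>l \<le> \<mu>\<^sub>h \<Longrightarrow> mono (service_rate T \<mu>\<^sub>l \<mu>\<^sub>h)"
  by (auto simp: mono_def service_rate_def)

section \<open>The delay as a function of \<open>q\<close>\<close>

locale threshold_queue =
  fixes lam :: real and \<mu> :: "nat \<Rightarrow> real" and M :: nat
  assumes lam_pos: "0 < lam" and rate_pos: "\<And>k. 0 < \<mu> k"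
begin

definition W :: "real \<Rightarrow> nat \<Rightarrow> nat \<Rightarrow> real" where
  "W q i k = delay lam \<mu> i k (threshold_mix M q)"

text \<open>The delay remaining after the next service completion, if nobody joins before it.\<close>

definition residual :: "real \<Rightarrow> nat \<Rightarrow> nat \<Rightarrow> real" where
  "residual q i k = (if i = 0 then 0 else W q (i - 1) (k - 1))"

lemma residual_simps [simp]:
  "residual q 0 k = 0" "residual q (Suc i) (Suc k) = W q i k"
  by (simp_all add: residual_def)

lemma W_step:
  assumes "0 \<le> q"
  shows "(lam * threshold_mix M q k + \<mu> k) * W q i k =
    1 + lam * threshold_mix M q k * W q i (Suc k) + \<mu> k * residual q i k"
proof -
  have "0 \<le> lam * threshold_mix M q k" for k
    using assms lam_pos by (simp add: threshold_mix_def)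
  \<comment> \<open>At \<open>M\<close> itself the joining probability is \<open>q\<close>, which
    may be positive, so the cutoff is \<open>Suc M\<close>.\<close>
  moreover have "threshold_mix M q k = 0" if "Suc M \<le> k" for k
    using that by (simp add: threshold_mix_def)
  ultimately show ?thesis
    using delay_first_step[of lam "threshold_mix M q" \<mu> "Suc M" k i] rate_pos
    by (simp add: W_def residual_def)
qed

text \<open>Nobody joins above \<open>M\<close>, so the recursion loses its upward term; this
  anchors the downward inductions on \<open>k\<close>.\<close>

lemma W_beyond:
  assumes "M < k" "0 \<le> q"
  shows "W q i k = 1 / \<mu> k + residual q i k"
  using W_step[OF assms(2), of k i] rate_pos[of k] assms(1)
  by (simp add: threshold_mix_def field_simps)

text \<open>The recursion is solved downward in \<open>k\<close> from \<open>Suc M\<close>, for each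
  \<open>i\<close> in turn, by sums, products and quotients of continuous functions. The domain
  \<open>q \<ge> 0\<close> keeps the denominators positive.\<close>

lemma continuous_on_W: "continuous_on {0..} (\<lambda>q. W q i k)"
proof (induction i arbitrary: k)
  \<comment> \<open>Continuity of \<open>residual\<close> is a premise here, so that this serves
    \<open>i = 0\<close> and the induction step alike.\<close>
  have *: "continuous_on {0..} (\<lambda>q. W q i k)"
    if res: "\<And>k. continuous_on {0..} (\<lambda>q. residual q i k)" for i k
  proof (induction "Suc M - k" arbitrary: k)
    case 0
    have "continuous_on {0..} (\<lambda>q. 1 / \<mu> k + residual q i k)"
      using rate_pos[of k] by (intro continuous_intros res)
    also have "?this \<longleftrightarrow> ?case"
      using 0 by (intro continuous_on_cong) (simp_all add: W_beyond)
    finally show ?case .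
  next
    case (Suc d)
    have IH: "continuous_on {0..} (\<lambda>q. W q i (Suc k))"
      using Suc by simp
    have pos: "0 < lam * threshold_mix M q k + \<mu> k" if "0 \<le> q" for q
      using lam_pos rate_pos[of k] that by (simp add: threshold_mix_def add_nonneg_pos)
    have "continuous_on {0..} (\<lambda>q. threshold_mix M q k)"
      by (cases "k < M"; cases "k = M") (simp_all add: threshold_mix_def)
    then have "continuous_on {0..} (\<lambda>q. (1 + lam * threshold_mix M q k * W q i (Suc k) + \<mu> k * residual q i k)
        / (lam * threshold_mix M q k + \<mu> k))"
      using pos by (intro continuous_intros IH res) (auto simp: less_imp_neq[symmetric])
    also have "?this \<longleftrightarrow> ?case"
      using pos W_step[of _ k i]
      by (intro continuous_on_cong) (simp_all add: nonzero_divide_eq_eq less_imp_neq[symmetric] mult.commute)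
    finally show ?case .
  qed
  {
    case 0
    show ?case
      by (rule *) simp
  next
    case (Suc i)
    show ?case
      by (rule *) (simp add: residual_def Suc)
  }
qed

text \<open>An extra customer does not lower the current service rate and, by induction on
  \<open>i\<close>, does not lengthen what remains after the next service. For fixed
  \<open>i\<close> the induction runs down from \<open>M\<close>, where nobody joins under
  \<open>q = 0\<close> and the rates at \<open>M\<close> and \<open>Suc M\<close> agree.\<close>

lemma W_antimono_total:
  assumes "mono \<mu>" "\<mu> (Suc M) = \<mu> M"
  shows "i < k \<Longrightarrow> k \<le> M \<Longrightarrow> W 0 i (Suc k) \<le> W 0 i k"
proof (induction i arbitrary: k)
  have *: "W 0 i (Suc k) \<le> W 0 i k"
    if res: "\<And>k. i < k \<Longrightarrow> k \<le> M \<Longrightarrow> residual 0 i (Suc k) \<le> residual 0 i k" and "i < k" "k \<le> M" for i k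
    using \<open>k \<le> M\<close> \<open>i < k\<close>
  proof (induction rule: inc_induct)
    case base
    then have "residual 0 i (Suc M) \<le> residual 0 i M"
      by (intro res) simp_all
    moreover have "W 0 i M = 1 / \<mu> M + residual 0 i M"
      using W_step[of 0 M i] rate_pos[of M] by (simp add: threshold_mix_def field_simps)
    ultimately show ?case
      using W_beyond[of "Suc M" 0 i] assms(2) by simp
  next
    case (step k)
    \<comment> \<open>Monotonicity at \<open>k + 1\<close> bounds \<open>W 0 i (k + 1)\<close> by its value without further arrivals.\<close>
    let ?a = "\<mu> k" and ?b = "\<mu> (Suc k)" and ?l = "lam * threshold_mix M 0 (Suc k)"
    have "?l * W 0 i (Suc (Suc k)) \<le> ?l * W 0 i (Suc k)"
      using step lam_pos by (intro mult_left_mono) (simp_all add: threshold_mix_def)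
    then have "?b * W 0 i (Suc k) \<le> 1 + ?b * residual 0 i (Suc k)"
      using W_step[of 0 "Suc k" i] by (simp add: algebra_simps)
    then have "W 0 i (Suc k) \<le> 1 / ?b + residual 0 i (Suc k)"
      using rate_pos[of "Suc k"] by (simp add: field_simps)
    also have "\<dots> \<le> 1 / ?a + residual 0 i k"
      using step rate_pos[of k] monoD[OF assms(1), of k "Suc k"]
      by (intro add_mono res) (simp_all add: frac_le)
    finally have "?a * W 0 i (Suc k) \<le> 1 + ?a * residual 0 i k"
      using rate_pos[of k] by (simp add: field_simps)
    \<comment> \<open>Adding \<open>lam * W 0 i (Suc k)\<close> to both sides makes the right-hand
      side that of the first-step equation at \<open>k\<close>, where joining is certain since
      \<open>k < M\<close>.\<close>
    then have "(lam + ?a) * W 0 i (Suc k) \<le> (lam + ?a) * W 0 i k"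
      using W_step[of 0 k i] step by (simp add: threshold_mix_def algebra_simps)
    then show ?case
      using lam_pos rate_pos[of k] by (simp add: mult_le_cancel_left)
  qed
  {
    case 0
    then show ?case
      by (intro *) simp_all
  next
    case (Suc i)
    show ?case
    proof (rule *)
      fix k assume "Suc i < k" "k \<le> M"
      then show "residual 0 (Suc i) (Suc k) \<le> residual 0 (Suc i) k"
        using Suc.IH[of "k - 1"] by (cases k) simp_all
    qed (use Suc in simp_all)
  }
qed

text \<open>Comparison principle: the right-hand side of the recursion for \<open>q\<close> is
  monotone in the values at the successor states, so it suffices that \<open>W 0\<close> satisfies
  this recursion with \<open>\<ge>\<close>. At \<open>M\<close> this follows from
  \<open>W_antimono_total\<close>, as joining leads to a state that is no worse.\<close>

lemma W_mix_le:
  assumes "mono \<mu>" "\<mu> (Suc M) = \<mu> M" "0 \<le> q"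
  shows "i < k \<Longrightarrow> k \<le> Suc M \<Longrightarrow> W q i k \<le> W 0 i k"
proof (induction i arbitrary: k)
  have *: "W q i k \<le> W 0 i k"
    if res: "\<And>k. i < k \<Longrightarrow> k \<le> Suc M \<Longrightarrow> residual q i k \<le> residual 0 i k" and "i < k" "k \<le> Suc M" for i k
    using \<open>k \<le> Suc M\<close> \<open>i < k\<close>
  proof (induction rule: inc_induct)
    case base
    then show ?case
      using res[of "Suc M"] assms(3) by (simp add: W_beyond)
  next
    case (step k)
    let ?l = "lam * threshold_mix M q k"
    have l: "0 \<le> ?l"
      using lam_pos assms(3) by (simp add: threshold_mix_def)
    have IH: "W q i (Suc k) \<le> W 0 i (Suc k)"
      using step by simp
    have "(?l + \<mu> k) * W q i k = 1 + ?l * W q i (Suc k) + \<mu> k * residual q i k"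
      by (rule W_step) fact
    also have "\<dots> \<le> 1 + ?l * W 0 i (Suc k) + \<mu> k * residual 0 i k"
      using step rate_pos[of k] by (intro add_mono mult_left_mono IH l res) simp_all
    also have "\<dots> \<le> (?l + \<mu> k) * W 0 i k"
      \<comment> \<open>\<open>W 0\<close> is a supersolution of the recursion for \<open>q\<close>; only at \<open>M\<close> do the two recursions differ.\<close>
    proof (cases "k = M")
      case True
      then have "?l * W 0 i (Suc k) \<le> ?l * W 0 i k"
        using step by (intro mult_left_mono l W_antimono_total assms) simp_all
      then show ?thesis
        using W_step[of 0 k i] True by (simp add: threshold_mix_def algebra_simps)
    next
      case False
      then have "threshold_mix M q k = threshold_mix M 0 k"
        by (simp add: threshold_mix_def)
      then show ?thesis
        using W_step[of 0 k i] by simp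
    qed
    finally show ?case
      using l rate_pos[of k] by (simp add: mult_le_cancel_left)
  qed
  {
    case 0
    then show ?case
      by (intro *) simp_all
  next
    case (Suc i)
    show ?case
    proof (rule *)
      fix k assume "Suc i < k" "k \<le> Suc M"
      then show "residual q (Suc i) k \<le> residual 0 (Suc i) k"
        using Suc.IH[of "k - 1"] by (cases k) simp_all
    qed (use Suc in simp_all)
  }
qed

end

section \<open>The indifferent customer and the mixed equilibrium\<close>

theorem mainTheorem8:
  fixes lam R C \<mu>\<^sub>l \<mu>\<^sub>h :: real and T N :: nat
  assumes "lam > 0" and "R \<ge> 0" and "C > 0"
    and "T \<ge> 1" and "0 < \<mu>\<^sub>l" and "\<mu>\<^sub>l < \<mu>\<^sub>h"
    and "N - 1 \<ge> T + 1"
    and "recurrent_class_equilibrium lam (service_rate T \<mu>\<^sub>l \<mu>\<^sub>h) (R / C) (pure_threshold (N - 1))"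
    and "recurrent_class_equilibrium lam (service_rate T \<mu>\<^sub>l \<mu>\<^sub>h) (R / C) (pure_threshold N)"
    and "delay lam (service_rate T \<mu>\<^sub>l \<mu>\<^sub>h) (N - 2) (N - 1) (pure_threshold (N - 1)) > R / C - 1 / \<mu>\<^sub>h"
    and "delay lam (service_rate T \<mu>\<^sub>l \<mu>\<^sub>h) (N - 1) N (pure_threshold N) < R / C"
  shows "\<exists>x. real N - 1 < x \<and> x < real N \<and>
    recurrent_class_equilibrium lam (service_rate T \<mu>\<^sub>l \<mu>\<^sub>h) (R / C) (mixed_threshold x)"
proof -
  define M where "M = N - 1"
  define r where "r = R / C"
  have N: "N = Suc M" "N - 1 = M" "N - 2 = M - 1"
    using assms(7) by (simp_all add: M_def)
  have M: "T < M" "0 < M"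
    using assms(7) by (simp_all add: M_def)
  define \<mu> where "\<mu> = service_rate T \<mu>\<^sub>l \<mu>\<^sub>h"
  have \<mu>_above: "\<mu> k = \<mu>\<^sub>h" if "T < k" for k
    using that by (simp add: \<mu>_def service_rate_def)
  interpret threshold_queue lam \<mu> M
    using assms(1,5,6) by unfold_locales (simp_all add: \<mu>_def service_rate_def)
  have mono: "mono \<mu>" "\<mu> (Suc M) = \<mu> M"
    using mono_service_rate[of \<mu>\<^sub>l \<mu>\<^sub>h T] assms(6) M by (simp_all add: \<mu>_def[symmetric] \<mu>_above)
  have "r - 1 / \<mu>\<^sub>h < W 0 (M - 1) M"
    using assms(10)[folded \<mu>_def r_def] by (simp only: N(2,3) W_def pure_threshold_eq_mix)
  then have at_0: "r \<le> W 0 M (Suc M)"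
    using M by (simp add: W_beyond \<mu>_above residual_def)
  \<comment> \<open>Strictness at the left end; it excludes \<open>q = 0\<close> among the solutions
    given by the intermediate value theorem.\<close>
  have "W 0 M (Suc M) \<noteq> r"
    using \<open>r - 1 / \<mu>\<^sub>h < W 0 (M - 1) M\<close> M by (simp add: W_beyond \<mu>_above residual_def)
  moreover have at_1: "W 1 M (Suc M) < r"
    using assms(11)[folded \<mu>_def r_def] by (simp only: N diff_Suc_1 W_def pure_threshold_Suc_eq_mix)
  moreover obtain q where "0 \<le> q" "q \<le> 1" and q_eq: "W q M (Suc M) = r"
    using IVT2'[of "\<lambda>q. W q M (Suc M)" 1 r 0] at_0 at_1
      continuous_on_subset[OF continuous_on_W, of "{0..1}" M "Suc M"] by auto
  ultimately have q: "0 < q" "q < 1"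
    by (metis order_less_le order_less_irrefl)+
  have below: "arrival_delay lam \<mu> n (threshold_mix M q) \<le> r" if "n < M" for n
  proof -
    have "W q n (Suc n) \<le> W 0 n (Suc n)"
      using that q mono by (intro W_mix_le) simp_all
    \<comment> \<open>In the pure equilibrium with threshold \<open>M\<close> every
      \<open>n < M\<close> is joined with probability 1, so its delay is at most
      \<open>r\<close>.\<close>
    also have "\<dots> \<le> r"
      using assms(8)[folded \<mu>_def r_def] that
      by (auto simp: recurrent_class_equilibrium_def balking_level_pure_threshold N W_def
          pure_threshold_def simp flip: pure_threshold_eq_mix)
    finally show ?thesis
      by (simp add: W_def)
  qed
  \<comment> \<open>With \<open>Suc (Suc M)\<close> present nobody joins, and one service later the
    tagged customer is in state \<open>(M, Suc M)\<close>, whose delay is exactly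
    \<open>r\<close>.\<close>
  have above: "r \<le> arrival_delay lam \<mu> (Suc M) (threshold_mix M q)"
    using W_beyond[of "Suc (Suc M)" q "Suc M"] q q_eq rate_pos[of "Suc (Suc M)"]
    by (simp flip: W_def)
  have "recurrent_class_equilibrium lam \<mu> r (threshold_mix M q)"
    unfolding recurrent_class_equilibrium_def
  proof (intro conjI allI impI)
    show "strategy (threshold_mix M q)"
      using q by (simp add: strategy_def threshold_mix_def)
    show "\<exists>n. threshold_mix M q n = 0"
      by (rule exI[of _ "Suc M"]) (simp add: threshold_mix_def)
  next
    fix n assume "n \<le> balking_level (threshold_mix M q)" "threshold_mix M q n = 0"
    \<comment> \<open>Below \<open>M\<close> the joining probability is 1 and at \<open>M\<close> it
      is \<open>q > 0\<close>, so only the balking level itself remains.\<close>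
    then have "n = Suc M"
      using q by (auto simp: balking_level_threshold_mix threshold_mix_def split: if_splits)
    then show "r - arrival_delay lam \<mu> n (threshold_mix M q) \<le> 0"
      using above by simp
  next
    fix n assume "threshold_mix M q n = 1"
    then show "0 \<le> r - arrival_delay lam \<mu> n (threshold_mix M q)"
      using below[of n] q by (auto simp: threshold_mix_def split: if_splits)
  next
    fix n assume "0 < threshold_mix M q n \<and> threshold_mix M q n < 1"
    then have "n = M"
      by (auto simp: threshold_mix_def split: if_splits)
    then show "r - arrival_delay lam \<mu> n (threshold_mix M q) = 0"
      using q_eq by (simp add: W_def)
  qed
  then show ?thesis
    \<comment> \<open>The witness has integer part \<open>M\<close> and fractional part
      \<open>q\<close>, so it lies strictly between \<open>N - 1\<close> and
      \<open>N\<close>.\<close>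
    using q by (intro exI[of _ "real M + q"]) (simp add: N mixed_threshold_eq_mix r_def \<mu>_def)
qed

end
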